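(* Every finite tournament $T$ in which every vertex has out-degree at least $2^{10}$ is $\frac{1}{2}$-majority $3$-colourable; that is, there is a map $c:V(T)\to\{1,2,3\}$ such that for every vertex $v$, the number of out-neighbours $w$ of $v$ with $c(w)=c(v)$ is at most $d^{+}(v)/2$, where $d^{+}(v)$ is the out-degree of $v$.
   Context: A tournament is a digraph in which for every pair of distinct vertices $u,v$ exactly one of the arcs $uv$, $vu$ is present. *)

theory Defs
  imports Complex_Main "Graph_Theory.Digraph"
begin

text \<open>
  The locale \<open>digraph\<close> already provides finiteness and excludes loops and parallel arcs,
  so every tournament here is finite.
\<close>

locale tournament = digraph +
  assumes exactly_one_arc:
    "\<lbrakk>u \<in> verts G; v \<in> verts G; u \<noteq> v\<rbrakk> \<Longrightarrow> (u \<rightarrow> v) \<longleftrightarrow> \<not> (v \<rightarrow> u)"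

definition out_neighbours :: "('a, 'b) pre_digraph \<Rightarrow> 'a \<Rightarrow> 'a set" where
  "out_neighbours G v = {w \<in> verts G. v \<rightarrow>\<^bsub>G\<^esub> w}"

definition majority_colouring ::
    "real \<Rightarrow> nat \<Rightarrow> ('a, 'b) pre_digraph \<Rightarrow> ('a \<Rightarrow> nat) \<Rightarrow> bool" where
  "majority_colouring \<alpha> k G c \<longleftrightarrow>
     c ` verts G \<subseteq> {1..k} \<and>
     (\<forall>v \<in> verts G.
        real (card {w \<in> out_neighbours G v. c w = c v}) \<le> \<alpha> * real (out_degree G v))"

definition majority_colourable :: "real \<Rightarrow> nat \<Rightarrow> ('a, 'b) pre_digraph \<Rightarrow> bool" where
  "majority_colourable \<alpha> k G \<longleftrightarrow> (\<exists>c. majority_colouring \<alpha> k G c)"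

end

theory Submission
  imports Defs "HOL-Library.FuncSet"
begin

text \<open>
  Colour the vertices uniformly at random. For a vertex of out-degree \<open>d\<close>, Markov's inequality
  applied to \<open>2\<close> to the power of the number of equally coloured out-neighbours shows that the vertex
  is bad with probability at most \<open>(4 / 3)^d / 2^(d/2) = (2 * sqrt 2 / 3)^d\<close>. A tournament has at
  most \<open>2 * d + 1\<close> vertices of out-degree \<open>d\<close>, so a union bound over all vertices is dominated by
  the tail from \<open>2^10\<close> on of a convergent series, which is less than \<open>1\<close>.
\<close>

lemma (in digraph) out_degree_eq_card_out_neighbours:
  "out_degree G v = card (out_neighbours G v)"
proof -
  have "inj_on (head G) (out_arcs G v)"
    by (rule inj_onI) (auto simp: arc_to_ends_def intro!: no_multi_arcs)
  moreover have "head G ` out_arcs G v = out_neighbours G v"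
    by (force simp: out_neighbours_def arcs_ends_def arc_to_ends_def image_iff)
  ultimately show ?thesis
    by (metis card_image out_degree_def)
qed

text \<open>Double counting inside the set \<open>S\<close> of vertices of out-degree
  \<open>d\<close>: at most \<open>card S * d\<close> arcs stay in \<open>S\<close>, while every
  off-diagonal pair of \<open>S \<times> S\<close> is an arc or a reversed arc. Hence
  \<open>card S\<close> squared is at most \<open>card S + 2 * card S * d\<close>.\<close>

lemma (in tournament) card_out_degree_le:
  "card {v \<in> verts G. out_degree G v = d} \<le> 2 * d + 1"
proof -
  define S where "S = {v \<in> verts G. out_degree G v = d}"
  define A where "A = (SIGMA u:S. out_neighbours G u \<inter> S)"
  have finS: "finite S" by (simp add: S_def)
  have finA: "finite A" using finS by (auto simp: A_def)
  have "card A = (\<Sum>u\<in>S. card (out_neighbours G u \<inter> S))"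
    using finS by (simp add: A_def)
  also have "\<dots> \<le> (\<Sum>u\<in>S. d)"
  proof (rule sum_mono)
    fix u assume "u \<in> S"
    have "card (out_neighbours G u \<inter> S) \<le> card (out_neighbours G u)"
      by (rule card_mono) (auto simp: out_neighbours_def)
    with \<open>u \<in> S\<close> show "card (out_neighbours G u \<inter> S) \<le> d"
      by (simp add: S_def out_degree_eq_card_out_neighbours)
  qed
  finally have cardA: "card A \<le> card S * d" by simp
  have "S \<times> S \<subseteq> Id_on S \<union> (A \<union> A\<inverse>)"
    using exactly_one_arc by (auto simp: S_def A_def out_neighbours_def Id_on_def)
  then have "card (S \<times> S) \<le> card (Id_on S \<union> (A \<union> A\<inverse>))"
    using finS finA by (intro card_mono) (auto simp: Id_on_def)
  also have "\<dots> \<le> card (Id_on S) + (card A + card (A\<inverse>))"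
    by (meson add_left_mono card_Un_le order_trans)
  also have "card (Id_on S) \<le> card S"
  proof -
    have "Id_on S = (\<lambda>x. (x, x)) ` S" by (auto simp: Id_on_def)
    then show ?thesis by (simp add: card_image_le finS)
  qed
  finally have *: "card S * card S \<le> card S * (2 * d + 1)"
    using cardA by (simp add: card_cartesian_product algebra_simps)
  show ?thesis
  proof (cases "card S = 0")
    case False
    with * have "card S \<le> 2 * d + 1"
      by (simp only: mult_le_cancel1)
    then show ?thesis by (simp only: S_def)
  qed (simp flip: S_def)
qed

text \<open>Splitting over the colour \<open>a\<close> of \<open>v\<close> makes the summand a product over the vertices.\<close>

lemma sum_power_same_colour:
  fixes x :: "'c::comm_semiring_1"
  assumes "finite V" "finite C" "v \<in> V" "N \<subseteq> V - {v}"
  shows "(\<Sum>c \<in> V \<rightarrow>\<^sub>E C. x ^ card {w \<in> N. c w = c v})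
    = (x + of_nat (card C - 1)) ^ card N * of_nat (card C) ^ (card V - card N)"
proof -
  \<comment> \<open>The factor at \<open>v\<close> is the indicator of colour \<open>a\<close>, so
    for a fixed colouring \<open>c\<close> only \<open>a = c v\<close> can contribute.\<close>
  define f :: "'b \<Rightarrow> 'a \<Rightarrow> 'b \<Rightarrow> 'c" where "f a w b = (if w = v then (if b = a then 1 else 0)
    else if w \<in> N then (if b = a then x else 1) else 1)" for a w b
  have finN: "finite N" using assms finite_subset by blast
  have sumf: "(\<Sum>b\<in>C. f a w b) = (if w = v then 1
    else if w \<in> N then x + of_nat (card C - 1) else of_nat (card C))" if "a \<in> C" for a w
  proof -
    have "card C = Suc (card C - 1)"
      using that assms(2) by (metis Suc_pred' card_gt_0_iff empty_iff)
    then have "(1 + of_nat (card C - 1) :: 'c) = of_nat (card C)"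
      by (metis of_nat_Suc)
    then show ?thesis
      using that assms(2) by (auto simp: f_def sum.remove[of C a])
  qed
  have prodf: "(\<Prod>w\<in>V. f a w (c w)) = (if c v = a then x ^ card {w \<in> N. c w = c v} else 0)" for a c
  proof -
    have "(\<Prod>w\<in>V. f a w (c w)) = f a v (c v) * (\<Prod>w\<in>V - {v}. f a w (c w))"
      using assms by (simp add: prod.remove)
    also have "(\<Prod>w\<in>V - {v}. f a w (c w)) = (\<Prod>w\<in>N. if c w = a then x else 1)"
      using assms by (intro prod.mono_neutral_cong_right) (auto simp: f_def)
    also have "\<dots> = x ^ card {w \<in> N. c w = a}"
      using finN by (simp add: prod.If_cases Int_def)
    finally show ?thesis by (auto simp: f_def)
  qed
  have card: "card (V - {v} - N) = card V - card N - 1"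
  proof -
    have "card (V - {v} - N) = card (V - {v}) - card N"
      using assms(4) finN by (rule card_Diff_subset[rotated])
    then show ?thesis
      using assms(1,3) by simp
  qed
  have "(\<Sum>c \<in> V \<rightarrow>\<^sub>E C. x ^ card {w \<in> N. c w = c v})
      = (\<Sum>c \<in> V \<rightarrow>\<^sub>E C. \<Sum>a\<in>C. \<Prod>w\<in>V. f a w (c w))"
    using assms by (intro sum.cong refl) (auto simp: prodf)
  also have "\<dots> = (\<Sum>a\<in>C. \<Sum>c \<in> V \<rightarrow>\<^sub>E C. \<Prod>w\<in>V. f a w (c w))"
    by (rule sum.swap)
  also have "\<dots> = (\<Sum>a\<in>C. \<Prod>w\<in>V. \<Sum>b\<in>C. f a w b)"
    using assms by (simp add: prod_sum_PiE)
  also have "\<dots> = (\<Sum>a\<in>C. (x + of_nat (card C - 1)) ^ card N * of_nat (card C) ^ (card V - card N - 1))"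
  proof (rule sum.cong[OF refl])
    fix a assume a: "a \<in> C"
    \<comment> \<open>Once \<open>a\<close> is fixed, \<open>v\<close> has a single admissible
      colour and contributes the factor 1.\<close>
    have "(\<Prod>w\<in>V. \<Sum>b\<in>C. f a w b) = (\<Prod>w\<in>V - {v}. \<Sum>b\<in>C. f a w b)"
      using assms by (simp add: prod.remove[of V v] sumf[OF a])
    also have "\<dots> = (\<Prod>w\<in>V - {v} - N. \<Sum>b\<in>C. f a w b) * (\<Prod>w\<in>N. \<Sum>b\<in>C. f a w b)"
      using assms by (intro prod.subset_diff) auto
    also have "(\<Prod>w\<in>V - {v} - N. \<Sum>b\<in>C. f a w b) = (\<Prod>w\<in>V - {v} - N. of_nat (card C))"
      by (intro prod.cong) (auto simp: sumf[OF a])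
    also have "(\<Prod>w\<in>N. \<Sum>b\<in>C. f a w b) = (\<Prod>w\<in>N. x + of_nat (card C - 1))"
      using assms by (intro prod.cong) (auto simp: sumf[OF a])
    finally show "(\<Prod>w\<in>V. \<Sum>b\<in>C. f a w b)
        = (x + of_nat (card C - 1)) ^ card N * of_nat (card C) ^ (card V - card N - 1)"
      using card by (simp add: mult.commute)
  qed
  also have "\<dots> = (x + of_nat (card C - 1)) ^ card N * of_nat (card C) ^ Suc (card V - card N - 1)"
    by (simp add: algebra_simps)
  also have "Suc (card V - card N - 1) = card V - card N"
  proof -
    have "card N < card V" using assms by (intro psubset_card_mono) auto
    then show ?thesis by simp
  qed
  finally show ?thesis .
qed

text \<open>With base \<open>t\<close> in place of 2, Markov's inequality gives the factor
  \<open>(t + 2) / (3 * sqrt t)\<close> per out-neighbour; it is smallest at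
  \<open>t = 2\<close>.\<close>

lemma card_bad_colourings_le:
  assumes "finite V" "v \<in> V" "N \<subseteq> V - {v}"
  shows "real (card {c \<in> V \<rightarrow>\<^sub>E {1..3::nat}. card N < 2 * card {w \<in> N. c w = c v}})
    \<le> 3 ^ card V * (2 * sqrt 2 / 3) ^ card N"
proof -
  define B where "B = {c \<in> V \<rightarrow>\<^sub>E {1..3::nat}. card N < 2 * card {w \<in> N. c w = c v}}"
  have fin: "finite (V \<rightarrow>\<^sub>E {1..3::nat})" using assms by (intro finite_PiE) auto
  have "card N \<le> card V" using assms by (intro card_mono) auto
  \<comment> \<open>The Markov threshold is written as a power of \<open>sqrt 2\<close>, so that an
    odd \<open>card N\<close> need not be halved.\<close>
  have "real (card B) * sqrt 2 ^ card N = (\<Sum>c\<in>B. sqrt 2 ^ card N)" by simp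
  also have "\<dots> \<le> (\<Sum>c\<in>B. 2 ^ card {w \<in> N. c w = c v})"
  proof (rule sum_mono)
    fix c assume "c \<in> B"
    then have "sqrt 2 ^ card N \<le> sqrt 2 ^ (2 * card {w \<in> N. c w = c v})"
      by (intro power_increasing) (auto simp: B_def)
    then show "sqrt 2 ^ card N \<le> 2 ^ card {w \<in> N. c w = c v}"
      by (simp add: power_mult)
  qed
  also have "\<dots> \<le> (\<Sum>c \<in> V \<rightarrow>\<^sub>E {1..3::nat}. 2 ^ card {w \<in> N. c w = c v})"
    using fin by (intro sum_mono2) (auto simp: B_def)
  also have "\<dots> = 4 ^ card N * 3 ^ (card V - card N)"
    using assms by (subst sum_power_same_colour) auto
  also have "\<dots> = 3 ^ card V * (4 / 3) ^ card N"
    using \<open>card N \<le> card V\<close> by (simp add: power_diff power_divide)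
  \<comment> \<open>This splits off the threshold \<open>sqrt 2 ^ card N\<close>, to be cancelled on
    both sides.\<close>
  also have "(4 / 3 :: real) = 2 * sqrt 2 / 3 * sqrt 2" by simp
  finally have "real (card B) * sqrt 2 ^ card N
      \<le> 3 ^ card V * (2 * sqrt 2 / 3) ^ card N * sqrt 2 ^ card N"
    by (simp only: power_mult_distrib mult.assoc)
  then show ?thesis by (simp add: B_def)
qed

text \<open>The linear factor is absorbed by an exponential with base close to 1:
  \<open>2 * sqrt 2 / 3\<close> is below \<open>943 / 1000\<close>, and multiplying this by
  \<open>257 / 250\<close> still stays below \<open>97 / 100\<close>.\<close>

lemma linear_times_power_le:
  assumes "512 \<le> d"
  shows "real (2 * d + 1) * (2 * sqrt 2 / 3) ^ d \<le> (97 / 100) ^ d"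
proof -
  have "sqrt 2 \<le> 2829 / 2000"
    by (rule real_le_lsqrt) (auto simp: power2_eq_square)
  then have "(2 * sqrt 2 / 3) ^ d \<le> (943 / 1000) ^ d"
    by (intro power_mono) auto
  moreover have "real (2 * d + 1) \<le> (257 / 250) ^ d"
    using assms
  proof (induction d rule: dec_induct)
    case base
    \<comment> \<open>As 512 is \<open>32 * 16\<close>, the power is evaluated in two stages with
      small numerals, through \<open>12 / 5 \<le> (257 / 250) ^ 32\<close>.\<close>
    have "real (2 * 512 + 1) \<le> (12 / 5) ^ 16" by (simp add: power_divide)
    also have "\<dots> \<le> ((257 / 250) ^ 32) ^ 16"
      by (rule power_mono) (simp_all add: power_divide)
    also have "\<dots> = (257 / 250) ^ (32 * 16)" by (rule power_mult[symmetric])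
    finally show ?case by (simp only: numeral_times_numeral semiring_norm)
  next
    case (step n)
    \<comment> \<open>The left side grows by 2, the right side by at least
      \<open>7 / 250 * (2 * n + 1)\<close>, which exceeds 2 for \<open>n \<ge> 512\<close>.\<close>
    then show ?case by simp
  qed
  ultimately have "real (2 * d + 1) * (2 * sqrt 2 / 3) ^ d \<le> (257 / 250) ^ d * (943 / 1000) ^ d"
    by (intro mult_mono) auto
  also have "\<dots> = (257 / 250 * (943 / 1000)) ^ d" by (rule power_mult_distrib[symmetric])
  also have "\<dots> \<le> (97 / 100) ^ d" by (intro power_mono) auto
  finally show ?thesis .
qed

lemma sum_power_tail_less_1:
  assumes "finite D" "D \<subseteq> {128..}"
  shows "(\<Sum>d\<in>D. (97 / 100 :: real) ^ d) < 1"
proof -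
  obtain m where m: "D \<subseteq> {..<m}" using assms(1) finite_nat_iff_bounded by blast
  have "(\<Sum>d\<in>D. (97 / 100 :: real) ^ d) \<le> (\<Sum>d = 128..<128 + m. (97 / 100) ^ d)"
    using m assms(2) by (intro sum_mono2) force+
  also have "\<dots> = (97 / 100) ^ 128 * (\<Sum>d<m. (97 / 100) ^ d)"
    using sum.shift_bounds_nat_ivl[of "\<lambda>d. (97 / 100 :: real) ^ d" 0 128 m]
    by (simp add: power_add sum_distrib_right lessThan_atLeast0 mult.commute add.commute)
  \<comment> \<open>\<open>100 / 3\<close> is the sum of the full geometric series; the exponent 128
    is large enough to outweigh it.\<close>
  also have "\<dots> \<le> (97 / 100) ^ 128 * (100 / 3)"
    by (intro mult_left_mono) (auto simp: sum_gp_strict)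
  also have "\<dots> < 1" by (simp add: power_divide)
  finally show ?thesis .
qed

text \<open>Grouping the vertices by out-degree makes the bound independent of the number of
  vertices.\<close>

lemma (in tournament) sum_out_degree_power_less_1:
  assumes "\<And>v. v \<in> verts G \<Longrightarrow> 512 \<le> out_degree G v"
  shows "(\<Sum>v\<in>verts G. (2 * sqrt 2 / 3) ^ out_degree G v) < 1"
proof -
  let ?D = "out_degree G ` verts G"
  have "(\<Sum>v\<in>verts G. (2 * sqrt 2 / 3) ^ out_degree G v)
      = (\<Sum>d\<in>?D. \<Sum>v | v \<in> verts G \<and> out_degree G v = d. (2 * sqrt 2 / 3) ^ out_degree G v)"
    by (rule sum.image_gen) simp
  also have "\<dots> = (\<Sum>d\<in>?D. real (card {v \<in> verts G. out_degree G v = d}) * (2 * sqrt 2 / 3) ^ d)"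
    by simp
  also have "\<dots> \<le> (\<Sum>d\<in>?D. real (2 * d + 1) * (2 * sqrt 2 / 3) ^ d)"
    using card_out_degree_le by (intro sum_mono mult_right_mono of_nat_mono) auto
  also have "\<dots> \<le> (\<Sum>d\<in>?D. (97 / 100) ^ d)"
    using assms by (intro sum_mono linear_times_power_le) auto
  also have "\<dots> < 1"
    using assms by (intro sum_power_tail_less_1) force+
  finally show ?thesis .
qed

theorem theorem3:
  fixes T :: "('a, 'b) pre_digraph"
  assumes "tournament T"
    and "\<And>v. v \<in> verts T \<Longrightarrow> out_degree T v \<ge> 2 ^ 10"
  shows "majority_colourable (1 / 2) 3 T"
proof -
  interpret tournament T by fact
  let ?V = "verts T" and ?N = "out_neighbours T"
  \<comment> \<open>Probabilities are replaced by counts in this finite set of colourings, so each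
    bound carries the factor \<open>3 ^ card ?V\<close>.\<close>
  define F where "F = ?V \<rightarrow>\<^sub>E {1..3::nat}"
  define B where "B v = {c \<in> F. card (?N v) < 2 * card {w \<in> ?N v. c w = c v}}" for v
  have finF: "finite F" by (auto simp: F_def intro!: finite_PiE)
  have cardF: "card F = 3 ^ card ?V" by (simp add: F_def card_PiE)
  \<comment> \<open>The absence of loops keeps the colour of \<open>v\<close> independent of those
    of its out-neighbours.\<close>
  have N: "?N v \<subseteq> ?V - {v}" for v
    using adj_not_same by (auto simp: out_neighbours_def)
  have B: "real (card (B v)) \<le> 3 ^ card ?V * (2 * sqrt 2 / 3) ^ out_degree T v" if "v \<in> ?V" for v
    using card_bad_colourings_le[OF _ that N[of v]]
    by (simp add: B_def F_def out_degree_eq_card_out_neighbours)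
  have "real (card (\<Union>v\<in>?V. B v)) \<le> (\<Sum>v\<in>?V. real (card (B v)))"
    using card_UN_le[OF finite_verts, of B] by (simp flip: of_nat_sum)
  also have "\<dots> \<le> 3 ^ card ?V * (\<Sum>v\<in>?V. (2 * sqrt 2 / 3) ^ out_degree T v)"
    unfolding sum_distrib_left by (intro sum_mono B)
  also have "\<dots> < 3 ^ card ?V"
  proof -
    have "512 \<le> out_degree T v" if "v \<in> ?V" for v
      using assms(2)[OF that] by simp
    from sum_out_degree_power_less_1[OF this] show ?thesis by simp
  qed
  \<comment> \<open>The bad colourings do not exhaust \<open>F\<close>, so some colouring is good at
    all vertices simultaneously.\<close>
  finally have "real (card (\<Union>v\<in>?V. B v)) < real (card F)"
    by (simp add: cardF)
  then have "card (\<Union>v\<in>?V. B v) < card F"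
    by (simp only: of_nat_less_iff)
  moreover have "(\<Union>v\<in>?V. B v) \<subseteq> F" by (auto simp: B_def)
  ultimately have "(\<Union>v\<in>?V. B v) \<subset> F" by auto
  then obtain c where c: "c \<in> F" "\<And>v. v \<in> ?V \<Longrightarrow> c \<notin> B v" by blast
  have "majority_colouring (1 / 2) 3 T c"
    unfolding majority_colouring_def
  proof (intro conjI ballI)
    show "c ` ?V \<subseteq> {1..3}" using c(1) by (auto simp: F_def)
    fix v assume "v \<in> ?V"
    then have "2 * card {w \<in> ?N v. c w = c v} \<le> out_degree T v"
      using c by (simp add: B_def out_degree_eq_card_out_neighbours not_less)
    then show "real (card {w \<in> ?N v. c w = c v}) \<le> 1 / 2 * real (out_degree T v)"
      by linarith
  qed
  then show ?thesis by (auto simp: majority_colourable_def)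
qed

end
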